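(* Let $k,t$ be integers with $k=t^2\ge 9$, and let $H$ be a subgraph of the star $K_{1,\lceil (k-2)/2\rceil}$ with $|E(H)|\ge 3$. Then $$\operatorname{bi-GM}_{k-1}(K_{1,3}:H)=\begin{cases}5, & t=3;\\ 30, & t=4;\\ (2t-1)\binom{t}{3}+\binom{t-2}{3}+2\binom{t-2}{2}, & t\ge 5.\end{cases}$$
   Context: All graphs are finite, simple and without isolated vertices. $K_{m,n}$ is the complete bipartite graph. A $k$-edge-coloring of a graph is a map from its edge set onto $\{1,\dots,k\}$ that is exact, i.e. every one of the $k$ colors is used at least once. An edge-colored graph is rainbow if all its edges have distinct colors and monochromatic if all its edges have the same color. A copy of a graph $F$ in a graph $G$ is a subgraph of $G$ isomorphic to $F$; distinct copies are distinct subgraphs. For non-empty bipartite graphs $G,H$ and a positive integer $k$, the bipartite Gallai-Ramsey number $\operatorname{bgr}_k(G:H)$ is the minimum integer $N$ such that for all $n\ge N$, every (exact) $k$-edge-coloring of $K_{n,n}$ contains a rainbow copy of $G$ or a monochromatic copy of $H$. The bipartite Gallai-Ramsey multiplicity $\operatorname{bi-GM}_k(G:H)$ is the minimum, over all (exact) $k$-edge-colorings of $K_{N,N}$ with $N=\operatorname{bgr}_k(G:H)$, of the total number of rainbow copies of $G$ plus monochromatic copies of $H$.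
   Formalization: In the definition of bgr_k(G:H), N is also required to satisfy N² ≥ k, so that K_{N,N} has an exact k-edge-coloring; otherwise small n satisfy the condition vacuously and bi-GM would be a minimum over no colorings. *)

theory Defs
  imports Complex_Main
begin

text \<open>Pairs (vertex set, edge set). Well-formedness is imposed by \<open>sgraph\<close>, which, following the
  standing convention, also excludes isolated vertices.\<close>

type_synonym 'a graph = "'a set \<times> 'a set set"

abbreviation verts :: "'a graph \<Rightarrow> 'a set" where "verts G \<equiv> fst G"

abbreviation edges :: "'a graph \<Rightarrow> 'a set set" where "edges G \<equiv> snd G"

definition sgraph :: "'a graph \<Rightarrow> bool" where
  "sgraph G \<longleftrightarrow> finite (verts G) \<and> (\<forall>e\<in>edges G. e \<subseteq> verts G \<and> card e = 2)
     \<and> (\<forall>v\<in>verts G. \<exists>e\<in>edges G. v \<in> e)"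

definition subgraph :: "'a graph \<Rightarrow> 'a graph \<Rightarrow> bool" where
  "subgraph F G \<longleftrightarrow> sgraph F \<and> verts F \<subseteq> verts G \<and> edges F \<subseteq> edges G"

definition graph_iso :: "'a graph \<Rightarrow> 'b graph \<Rightarrow> bool" where
  "graph_iso F G \<longleftrightarrow> (\<exists>f. bij_betw f (verts F) (verts G) \<and> (\<lambda>e. f ` e) ` edges F = edges G)"

definition copies :: "'a graph \<Rightarrow> 'b graph \<Rightarrow> 'b graph set" where
  "copies F G = {S. subgraph S G \<and> graph_iso F S}"

definition complete_bipartite :: "nat \<Rightarrow> nat \<Rightarrow> (nat + nat) graph" where
  "complete_bipartite m n =
     (Inl ` {..<m} \<union> Inr ` {..<n}, {{Inl i, Inr j} | i j. i < m \<and> j < n})"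

definition exact_edge_coloring :: "nat \<Rightarrow> 'a graph \<Rightarrow> ('a set \<Rightarrow> nat) \<Rightarrow> bool" where
  "exact_edge_coloring k G c \<longleftrightarrow> c ` edges G = {1..k}"

definition rainbow :: "('a set \<Rightarrow> nat) \<Rightarrow> 'a graph \<Rightarrow> bool" where
  "rainbow c F \<longleftrightarrow> inj_on c (edges F)"

definition monochromatic :: "('a set \<Rightarrow> nat) \<Rightarrow> 'a graph \<Rightarrow> bool" where
  "monochromatic c F \<longleftrightarrow> (\<forall>e\<in>edges F. \<forall>e'\<in>edges F. c e = c e')"

definition rainbow_copies :: "('b set \<Rightarrow> nat) \<Rightarrow> 'a graph \<Rightarrow> 'b graph \<Rightarrow> 'b graph set" where
  "rainbow_copies c F G = {S \<in> copies F G. rainbow c S}"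

definition mono_copies :: "('b set \<Rightarrow> nat) \<Rightarrow> 'a graph \<Rightarrow> 'b graph \<Rightarrow> 'b graph set" where
  "mono_copies c F G = {S \<in> copies F G. monochromatic c S}"

text \<open>
  The conjunct \<open>k \<le> N\<^sup>2\<close> says that \<open>K\<^sub>N\<^sub>,\<^sub>N\<close> has an exact \<open>k\<close>-edge-coloring at all. Without it,
  values of \<open>n\<close> with \<open>n\<^sup>2 < k\<close> would satisfy the Ramsey condition vacuously, and the multiplicity
  below could be a minimum over an empty set of colorings.
\<close>

definition bgr :: "nat \<Rightarrow> 'a graph \<Rightarrow> 'b graph \<Rightarrow> nat" where
  "bgr k G H = (LEAST N. k \<le> N\<^sup>2 \<and>
     (\<forall>n\<ge>N. \<forall>c. exact_edge_coloring k (complete_bipartite n n) c \<longrightarrow>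
        rainbow_copies c G (complete_bipartite n n) \<noteq> {} \<or>
        mono_copies c H (complete_bipartite n n) \<noteq> {}))"

definition bi_GM :: "nat \<Rightarrow> 'a graph \<Rightarrow> 'b graph \<Rightarrow> nat" where
  "bi_GM k G H = (let K = complete_bipartite (bgr k G H) (bgr k G H) in
     (LEAST m. \<exists>c. exact_edge_coloring k K c \<and>
        m = card (rainbow_copies c G K) + card (mono_copies c H K)))"

end

theory Submission
  imports Defs
begin

text \<open>
  \<open>K\<^sub>t\<^sub>,\<^sub>t\<close> has \<open>t\<^sup>2\<close> edges, so an exact coloring with \<open>t\<^sup>2 - 1\<close> colors repeats exactly one color, on
  exactly two edges. There is then no monochromatic \<open>H\<close>, and a copy of \<open>K\<^sub>1\<^sub>,\<^sub>3\<close> fails to be rainbow iff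
  it contains both of these edges; this happens for at most \<open>t - 2\<close> of the \<open>2t (t choose 3)\<close> copies, with
  equality iff the two edges meet. Vandermonde turns \<open>2t (t choose 3) - (t - 2)\<close> into the stated form.

  That the bipartite Gallai-Ramsey number is \<open>t\<close> rests on the fact that a coloring of \<open>K\<^sub>n\<^sub>,\<^sub>n\<close>, \<open>n \<ge> 3\<close>,
  in which every vertex sees at most two colors has at most \<open>n + 1\<close> colors: without a rainbow
  \<open>K\<^sub>1\<^sub>,\<^sub>3\<close>, \<open>n\<close> is therefore so large that one of the two colors at a vertex forms a large star.
\<close>

declare One_nat_def [simp del]

section \<open>Copies and stars\<close>

definition neighbours :: "'a graph \<Rightarrow> 'a \<Rightarrow> 'a set" where
  "neighbours G v = {u. {v, u} \<in> edges G}"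

text \<open>The condition \<open>v \<notin> L\<close> is not built in; it follows from
  \<open>L \<subseteq> neighbours G v\<close> when \<open>G\<close> is an
  \<open>sgraph\<close>.\<close>

definition star :: "'a \<Rightarrow> 'a set \<Rightarrow> 'a graph" where
  "star v L = (insert v L, (\<lambda>u. {v, u}) ` L)"

lemma verts_star [simp]: "verts (star v L) = insert v L"
  and edges_star [simp]: "edges (star v L) = (\<lambda>u. {v, u}) ` L"
  by (simp_all add: star_def)

text \<open>Serves to carry a copy of \<open>H\<close> from an abstract star into the host graph:
  the isomorphism is composed with \<open>g\<close>, and injectivity keeps the images of edges
  two-element.\<close>

lemma copies_embed:
  assumes S: "S \<in> copies H G" and inj: "inj_on g (verts G)"
    and V: "g ` verts G \<subseteq> verts K" and E: "\<And>e. e \<in> edges G \<Longrightarrow> g ` e \<in> edges K"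
  shows "(g ` verts S, (`) g ` edges S) \<in> copies H K"
proof -
  from S obtain f where f: "bij_betw f (verts H) (verts S)" "(\<lambda>e. f ` e) ` edges H = edges S"
    and sg: "sgraph S" and sub: "verts S \<subseteq> verts G" "edges S \<subseteq> edges G"
    by (auto simp: copies_def subgraph_def graph_iso_def)
  have inj': "inj_on g (verts S)"
    using inj sub(1) by (rule inj_on_subset)
  have "card (g ` e) = 2" if "e \<in> edges S" for e
    using that sg inj' by (metis card_image inj_on_subset sgraph_def)
  then have "sgraph (g ` verts S, (`) g ` edges S)"
    using sg unfolding sgraph_def by (auto 0 4)
  then have "subgraph (g ` verts S, (`) g ` edges S) K"
    using V E sub by (auto simp: subgraph_def)
  moreover have "bij_betw (g \<circ> f) (verts H) (g ` verts S)"
    using f(1) inj' by (meson bij_betw_trans inj_on_imp_bij_betw)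
  then have "graph_iso H (g ` verts S, (`) g ` edges S)"
    unfolding graph_iso_def using f(2)
    by (intro exI[of _ "g \<circ> f"]) (simp add: image_image image_comp flip: f(2))
  ultimately show ?thesis
    by (simp add: copies_def)
qed

lemma card_edges_copy:
  assumes "S \<in> copies H G" "sgraph H"
  shows "card (edges S) = card (edges H)"
proof -
  from assms(1) obtain f where f: "bij_betw f (verts H) (verts S)" "(\<lambda>e. f ` e) ` edges H = edges S"
    by (auto simp: copies_def graph_iso_def)
  have "edges H \<subseteq> Pow (verts H)"
    using assms(2) by (auto simp: sgraph_def)
  then have "inj_on ((`) f) (edges H)"
    using f(1) by (metis bij_betw_def inj_on_image_Pow inj_on_subset)
  then show ?thesis
    using f(2) card_image by metis
qed

lemma sgraph_complete_bipartite:
  assumes "0 < m" "0 < n"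
  shows "sgraph (complete_bipartite m n)"
  unfolding sgraph_def
proof (intro conjI ballI)
  let ?G = "complete_bipartite m n"
  show "finite (verts ?G)"
    by (simp add: complete_bipartite_def)
  fix e assume "e \<in> edges ?G"
  then obtain i j where "e = {Inl i, Inr j}" "i < m" "j < n"
    by (auto simp: complete_bipartite_def)
  then show "e \<subseteq> verts ?G" "card e = 2"
    by (simp_all add: complete_bipartite_def)
next
  let ?G = "complete_bipartite m n"
  fix v assume "v \<in> verts ?G"
  then consider i where "v = Inl i" "i < m" | j where "v = Inr j" "j < n"
    by (auto simp: complete_bipartite_def)
  then show "\<exists>e\<in>edges ?G. v \<in> e"
  proof cases
    case 1
    with \<open>0 < n\<close> have "{v, Inr 0} \<in> edges ?G"
      by (auto simp: complete_bipartite_def)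
    then show ?thesis
      by blast
  next
    case 2
    with \<open>0 < m\<close> have "{Inl 0, v} \<in> edges ?G"
      by (auto simp: complete_bipartite_def)
    then show ?thesis
      by blast
  qed
qed

lemma edges_star_subset_iff: "edges (star v L) \<subseteq> edges G \<longleftrightarrow> L \<subseteq> neighbours G v"
  by (auto simp: neighbours_def)

lemma edges_complete_bipartite_1:
  "edges (complete_bipartite 1 m) = (\<lambda>j. {Inl 0, Inr j}) ` {..<m}"
  by (auto simp: complete_bipartite_def)

lemma verts_complete_bipartite_1:
  "verts (complete_bipartite 1 m) = insert (Inl 0) (Inr ` {..<m})"
  by (auto simp: complete_bipartite_def)

text \<open>Replaces isomorphism by explicit center-and-leaves data, so that copies can be counted.
  At \<open>m = 0\<close> the equation fails: a lone vertex is no \<open>sgraph\<close>, yet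
  \<open>star v {}\<close> would appear on the right.\<close>

lemma copies_star_eq:
  assumes G: "sgraph G" and "0 < m"
  shows "copies (complete_bipartite 1 m) G = {star v L | v L. L \<subseteq> neighbours G v \<and> card L = m}"
    (is "?A = ?B")
proof (intro set_eqI iffI)
  fix S assume "S \<in> ?A"
  then obtain f where f: "bij_betw f (verts (complete_bipartite 1 m)) (verts S)"
      "(\<lambda>e. f ` e) ` edges (complete_bipartite 1 m) = edges S" and sub: "edges S \<subseteq> edges G"
    by (auto simp: copies_def subgraph_def graph_iso_def)
  define v where "v = f (Inl 0)"
  define L where "L = (\<lambda>j. f (Inr j)) ` {..<m}"
  have "inj_on (\<lambda>j. f (Inr j)) {..<m}"
    using f(1) by (auto simp: bij_betw_def verts_complete_bipartite_1 inj_on_def)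
  then have "card L = m"
    by (simp add: L_def card_image)
  moreover have "verts S = insert v L"
    using f(1) by (auto simp: bij_betw_def verts_complete_bipartite_1 v_def L_def)
  moreover have "edges S = (\<lambda>u. {v, u}) ` L"
    using f(2) by (auto simp: edges_complete_bipartite_1 v_def L_def image_image)
  ultimately have "S = star v L"
    by (simp add: star_def prod_eq_iff)
  moreover from this sub have "L \<subseteq> neighbours G v"
    by (simp only: edges_star_subset_iff)
  ultimately show "S \<in> ?B"
    using \<open>card L = m\<close> by blast
next
  fix S assume "S \<in> ?B"
  then obtain v L where S: "S = star v L" and L: "L \<subseteq> neighbours G v" "card L = m"
    by blast
  have "finite L"
    using L(2) \<open>0 < m\<close> card_ge_0_finite by blast
  have E: "{v, u} \<in> edges G" if "u \<in> L" for u
    using that L(1) by (auto simp: neighbours_def)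
  then have uv: "u \<noteq> v \<and> u \<in> verts G \<and> v \<in> verts G" if "u \<in> L" for u
    using that G by (fastforce simp: sgraph_def)
  have "L \<noteq> {}"
    using L(2) \<open>0 < m\<close> by auto
  then have "sgraph S"
    using \<open>finite L\<close> uv by (auto simp: sgraph_def S card_insert_if)
  then have "subgraph S G"
    using uv E \<open>L \<noteq> {}\<close> by (auto simp: subgraph_def S)
  moreover obtain h where h: "bij_betw h {..<m} L"
    using \<open>finite L\<close> L(2) by (metis ex_bij_betw_nat_finite atLeast0LessThan)
  have "graph_iso (complete_bipartite 1 m) S"
    unfolding graph_iso_def
  proof (intro exI conjI)
    let ?f = "case_sum (\<lambda>_. v) h"
    show "bij_betw ?f (verts (complete_bipartite 1 m)) (verts S)"
      using h uv by (auto simp: bij_betw_def verts_complete_bipartite_1 S inj_on_def image_image)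
    show "(\<lambda>e. ?f ` e) ` edges (complete_bipartite 1 m) = edges S"
      using h by (auto simp: bij_betw_def edges_complete_bipartite_1 S image_image)
  qed
  ultimately show "S \<in> ?A"
    by (simp add: copies_def)
qed

text \<open>With two or more leaves the center is the only vertex common to all edges; with a single
  leaf the two ends could be exchanged.\<close>

lemma star_eq_iff:
  assumes "card L \<ge> 2" "v \<notin> L" "v' \<notin> L'"
  shows "star v L = star v' L' \<longleftrightarrow> v = v' \<and> L = L'"
proof
  assume eq: "star v L = star v' L'"
  then have V: "insert v L = insert v' L'" and E: "(\<lambda>u. {v, u}) ` L = (\<lambda>u. {v', u}) ` L'"
    by (simp_all add: star_def)
  have "v = v'"
  proof (rule ccontr)
    assume "v \<noteq> v'"
    have "u = v'" if "u \<in> L" for u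
    proof -
      have "{v, u} \<in> (\<lambda>u. {v', u}) ` L'"
        using E that by blast
      then show ?thesis
        using \<open>v \<noteq> v'\<close> by (auto simp: doubleton_eq_iff)
    qed
    then have "L \<subseteq> {v'}"
      by blast
    then show False
      using assms(1) card_mono[of "{v'}" L] by simp
  qed
  moreover have "L = L'"
    using V assms(2,3) \<open>v = v'\<close> by (metis insert_ident)
  ultimately show "v = v' \<and> L = L'" ..
qed auto

lemma not_in_neighbours: "sgraph G \<Longrightarrow> v \<notin> neighbours G v"
  by (auto simp: neighbours_def sgraph_def)

text \<open>For \<open>2 \<le> m\<close> a star determines its center and leaves, so pairs of a
  vertex and an \<open>m\<close>-set of its neighbours count every copy once. For
  \<open>m = 1\<close> every edge would be counted from both ends.\<close>

lemma card_copies_star: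
  assumes G: "sgraph G" and "2 \<le> m"
  shows "finite (copies (complete_bipartite 1 m) G)"
    and "card (copies (complete_bipartite 1 m) G) = (\<Sum>v\<in>verts G. card (neighbours G v) choose m)"
proof -
  let ?P = "Sigma (verts G) (\<lambda>v. {L. L \<subseteq> neighbours G v \<and> card L = m})"
  have nb: "neighbours G v \<subseteq> verts G" for v
    using G by (auto simp: neighbours_def sgraph_def)
  have finV: "finite (verts G)"
    using G by (simp add: sgraph_def)
  have fin: "finite (neighbours G v)" for v
    using nb finV by (rule finite_subset)
  have v: "v \<in> verts G" if "L \<subseteq> neighbours G v" "card L = m" for v L
  proof -
    have "L \<noteq> {}"
      using that \<open>2 \<le> m\<close> by auto
    then obtain u where "u \<in> L"
      by blast
    then have "{v, u} \<in> edges G"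
      using that(1) by (auto simp: neighbours_def)
    then show ?thesis
      using G by (auto simp: sgraph_def)
  qed
  have eq: "copies (complete_bipartite 1 m) G = (\<lambda>(v, L). star v L) ` ?P"
    using \<open>2 \<le> m\<close> v by (subst copies_star_eq[OF G]) force+
  have inj: "inj_on (\<lambda>(v, L). star v L) ?P"
  proof (rule inj_onI, clarify)
    fix v L v' L'
    assume "star v L = star v' L'" "L \<subseteq> neighbours G v" "L' \<subseteq> neighbours G v'" "m = card L"
    with \<open>2 \<le> m\<close> show "v = v' \<and> L = L'"
      using star_eq_iff not_in_neighbours[OF G] by (metis subsetD)
  qed
  have "finite {L. L \<subseteq> neighbours G v \<and> card L = m}" for v
    using fin[of v] by simp
  then show "finite (copies (complete_bipartite 1 m) G)"
    unfolding eq using finV by blast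
  show "card (copies (complete_bipartite 1 m) G) = (\<Sum>v\<in>verts G. card (neighbours G v) choose m)"
    unfolding eq card_image[OF inj] using fin finV by (simp add: n_subsets)
qed

section \<open>Balanced complete bipartite graphs\<close>

lemma complete_bipartite_edge_iff [simp]:
  "{Inl i, Inr j} \<in> edges (complete_bipartite m n) \<longleftrightarrow> i < m \<and> j < n"
  "{Inr j, Inl i} \<in> edges (complete_bipartite m n) \<longleftrightarrow> i < m \<and> j < n"
  "{Inl i, Inl i'} \<notin> edges (complete_bipartite m n)"
  "{Inr j, Inr j'} \<notin> edges (complete_bipartite m n)"
  by (auto simp: complete_bipartite_def doubleton_eq_iff)

lemma neighbours_Inl:
  "i < m \<Longrightarrow> neighbours (complete_bipartite m n) (Inl i) = Inr ` {..<n}"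
  unfolding neighbours_def
proof (intro set_eqI)
  fix u assume "i < m"
  then show "u \<in> {u. {Inl i, u} \<in> edges (complete_bipartite m n)} \<longleftrightarrow> u \<in> Inr ` {..<n}"
    by (cases u) auto
qed

lemma neighbours_Inr:
  "j < n \<Longrightarrow> neighbours (complete_bipartite m n) (Inr j) = Inl ` {..<m}"
  unfolding neighbours_def
proof (intro set_eqI)
  fix u assume "j < n"
  then show "u \<in> {u. {Inr j, u} \<in> edges (complete_bipartite m n)} \<longleftrightarrow> u \<in> Inl ` {..<m}"
    by (cases u) auto
qed

lemma card_neighbours:
  "v \<in> verts (complete_bipartite n n) \<Longrightarrow> card (neighbours (complete_bipartite n n) v) = n"
proof -
  assume "v \<in> verts (complete_bipartite n n)"
  then consider i where "v = Inl i" "i < n" | j where "v = Inr j" "j < n"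
    by (auto simp: complete_bipartite_def)
  then show ?thesis
    by cases (simp_all add: neighbours_Inl neighbours_Inr card_image)
qed

lemma edges_complete_bipartite:
  "edges (complete_bipartite m n) = (\<lambda>(i, j). {Inl i, Inr j}) ` ({..<m} \<times> {..<n})"
  by (auto simp: complete_bipartite_def)

lemma card_edges_complete_bipartite: "card (edges (complete_bipartite m n)) = m * n"
proof -
  have "inj_on (\<lambda>(i, j). {Inl i, Inr j}) ({..<m} \<times> {..<n})"
    by (auto simp: inj_on_def doubleton_eq_iff)
  then show ?thesis
    by (simp add: edges_complete_bipartite card_image)
qed

lemma card_verts_complete_bipartite: "card (verts (complete_bipartite m n)) = m + n"
proof -
  have "verts (complete_bipartite m n) = {..<m} <+> {..<n}"
    by (simp add: complete_bipartite_def Plus_def)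
  then show ?thesis
    by (simp add: card_Plus)
qed

lemma card_claws:
  assumes "0 < n"
  shows "card (copies (complete_bipartite 1 3) (complete_bipartite n n)) = 2 * n * (n choose 3)"
proof -
  have "sgraph (complete_bipartite n n)"
    using assms by (simp add: sgraph_complete_bipartite)
  then have "card (copies (complete_bipartite 1 3) (complete_bipartite n n))
      = (\<Sum>v\<in>verts (complete_bipartite n n). card (neighbours (complete_bipartite n n) v) choose 3)"
    by (rule card_copies_star) simp
  also have "\<dots> = (\<Sum>v\<in>verts (complete_bipartite n n). n choose 3)"
    by (intro sum.cong) (simp_all only: card_neighbours)
  finally show ?thesis
    by (simp only: sum_constant card_verts_complete_bipartite) (simp add: mult_2)
qed

section \<open>The bipartite Gallai-Ramsey number\<close>

text \<open>With \<open>n + 2\<close> colors, row 0 has two colors and every column has a color of its own, occurring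
  in no other column. A row through the own color of column \<open>j\<close> is constant elsewhere, so it agrees
  there with row 0; varying \<open>j\<close> makes row 0 constant.\<close>

lemma two_colored_lines:
  fixes f :: "nat \<Rightarrow> nat \<Rightarrow> 'a"
  assumes "3 \<le> n"
    and rows: "\<And>i. i < n \<Longrightarrow> card (f i ` {..<n}) \<le> 2"
    and cols: "\<And>j. j < n \<Longrightarrow> card ((\<lambda>i. f i j) ` {..<n}) \<le> 2"
  shows "card (\<Union>i<n. f i ` {..<n}) \<le> n + 1"
proof (rule ccontr)
  \<comment> \<open>Every column meets row 0, so beyond \<open>R\<close> column \<open>j\<close>
    contributes at most the one color in \<open>E j\<close>. This bounds the colors by 2 + n, and
    the assumed n + 2 colors make every estimate tight.\<close>
  define R where "R = f 0 ` {..<n}"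
  define E where "E j = (\<lambda>i. f i j) ` {..<n} - {f 0 j}" for j
  let ?C = "\<Union>i<n. f i ` {..<n}"
  assume "\<not> card ?C \<le> n + 1"
  then have C: "n + 2 \<le> card ?C"
    by simp
  have R2: "card R \<le> 2"
    using rows[of 0] \<open>3 \<le> n\<close> by (simp add: R_def)
  have finE: "finite (E j)" for j
    by (simp add: E_def)
  have E1: "card (E j) \<le> 1" if "j < n" for j
    using cols[OF that] \<open>3 \<le> n\<close> by (simp add: E_def card_Diff_singleton_if)
  have bound: "card (R \<union> (\<Union>j\<in>J. E j)) \<le> card R + card J" if "J \<subseteq> {..<n}" for J
  proof -
    have "finite J"
      using that finite_subset by blast
    have "card (\<Union>j\<in>J. E j) \<le> (\<Sum>j\<in>J. card (E j))"
      using \<open>finite J\<close> by (rule card_UN_le)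
    also have "\<dots> \<le> (\<Sum>j\<in>J. 1)"
      using E1 that by (intro sum_mono) auto
    finally have "card (\<Union>j\<in>J. E j) \<le> card J"
      by simp
    then show ?thesis
      using card_Un_le[of R "\<Union>j\<in>J. E j"] by linarith
  qed
  have CE: "?C \<subseteq> R \<union> (\<Union>j<n. E j)"
    unfolding R_def E_def by auto
  have finR: "finite R"
    by (simp add: R_def)
  have "card ?C \<le> card (R \<union> (\<Union>j<n. E j))"
    using CE finR finE by (intro card_mono) auto
  then have "card R = 2"
    using C R2 bound[of "{..<n}"] by simp
  \<comment> \<open>Without column \<open>j\<close> at most 2 + (n - 1) colors remain, so
    \<open>E j\<close> must supply a color found neither in \<open>R\<close> nor in another
    \<open>E j'\<close>.\<close>
  have own: "\<exists>x. E j = {x} \<and> x \<notin> R \<and> (\<forall>j'<n. j' \<noteq> j \<longrightarrow> x \<notin> E j')" if "j < n" for j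
  proof -
    let ?U = "R \<union> (\<Union>j'\<in>{..<n} - {j}. E j')"
    have "\<not> E j \<subseteq> ?U"
    proof
      assume "E j \<subseteq> ?U"
      then have "?C \<subseteq> ?U"
        using CE by blast
      then have "card ?C \<le> card ?U"
        using finR finE by (intro card_mono) auto
      then show False
        using C R2 bound[of "{..<n} - {j}"] that by auto
    qed
    then obtain x where x: "x \<in> E j" "x \<notin> ?U"
      by blast
    then have "E j = {x}"
      using E1[OF that] finE[of j] by (metis One_nat_def card_le_Suc0_iff_eq is_singletonI' is_singleton_the_elem
          empty_iff singletonD)
    then show ?thesis
      using x(2) by auto
  qed
  have same: "f 0 j' = f 0 j''" if jj: "j' < n" "j'' < n" for j' j''
  proof (cases "j' = j''")
    case False
    \<comment> \<open>A third column exists because n is at least 3. Its own color \<open>x\<close>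
      then marks a row \<open>i\<close> in which only one further color is possible.\<close>
    obtain j where j: "j < n" "j \<noteq> j'" "j \<noteq> j''"
    proof -
      have "card {j', j''} < card {..<n}"
        using False \<open>3 \<le> n\<close> by simp
      then have "\<not> {..<n} \<subseteq> {j', j''}"
        by (metis card_mono finite.intros leD)
      then show ?thesis
        using that by blast
    qed
    obtain x where x: "E j = {x}" "x \<notin> R" "\<And>l. l < n \<Longrightarrow> l \<noteq> j \<Longrightarrow> x \<notin> E l"
      using own[OF j(1)] by blast
    then have "x \<in> (\<lambda>i. f i j) ` {..<n}"
      unfolding E_def by blast
    then obtain i where i: "i < n" "f i j = x"
      by blast
    have cases: "f i l = f 0 l \<or> f i l \<in> E l" for l
      using i(1) by (auto simp: E_def)
    have inR: "f 0 l \<in> R" if "l < n" for l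
      using that by (simp add: R_def)
    have ne: "f i l \<noteq> x" if "l < n" "l \<noteq> j" for l
      using cases[of l] inR[of l] x that by metis
    have "f i j' = f i j''"
    proof (rule ccontr)
      assume "f i j' \<noteq> f i j''"
      then have "card {x, f i j', f i j''} = 3"
        using ne[of j'] ne[of j''] j that by auto
      moreover have "card {x, f i j', f i j''} \<le> card (f i ` {..<n})"
        using i j that by (intro card_mono) auto
      ultimately show False
        using rows[OF i(1)] by simp
    qed
    \<comment> \<open>The own colors \<open>y\<close> and \<open>z\<close> of the two columns differ
      and avoid \<open>R\<close>, so equal entries in row \<open>i\<close> can only be the entries
      of row 0.\<close>
    moreover obtain y where "E j' = {y}" "y \<notin> R" "y \<notin> E j''"
      using own[OF jj(1)] jj(2) False by metis
    moreover obtain z where "E j'' = {z}" "z \<notin> R" "z \<notin> E j'"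
      using own[OF jj(2)] jj(1) False by metis
    ultimately show ?thesis
      using cases[of j'] cases[of j''] inR jj by (metis singletonD)
  qed simp
  have "R \<subseteq> {f 0 0}"
  proof
    fix x assume "x \<in> R"
    then obtain j where "j < n" "x = f 0 j"
      unfolding R_def by blast
    then show "x \<in> {f 0 0}"
      using same[of j 0] \<open>3 \<le> n\<close> by simp
  qed
  then show False
    using \<open>card R = 2\<close> card_mono[of "{f 0 0}" R] by simp
qed

text \<open>Pigeonhole with two classes: if both had at most m - 1 elements, \<open>A\<close> would
  have at most 2m - 2, whereas the hypothesis gives at least 2m - 1.\<close>

lemma large_fibre:
  assumes "finite A" "card (f ` A) \<le> 2" "2 * m \<le> card A + 1"
  obtains x where "m \<le> card {a \<in> A. f a = x}"
proof (rule ccontr)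
  assume no: "\<not> thesis"
  then have small: "card {a \<in> A. f a = x} < m" for x
    using that not_less by blast
  \<comment> \<open>Makes the natural-number difference \<open>m - 1\<close> below exact.\<close>
  then have "1 \<le> m"
    using not_less_zero by (metis One_nat_def Suc_leI gr0I)
  have "card A = (\<Sum>x\<in>f ` A. card {a \<in> A. f a = x})"
    using sum.image_gen[OF assms(1), of "\<lambda>_. 1 :: nat" f] by (simp only: card_eq_sum)
  also have "\<dots> \<le> (\<Sum>x\<in>f ` A. m - 1)"
    using small by (intro sum_mono) (metis Suc_pred' \<open>1 \<le> m\<close> diff_Suc_1 less_Suc_eq_le less_le_trans zero_less_one)
  also have "\<dots> \<le> 2 * (m - 1)"
    using assms(2) by simp
  finally show False
    using assms(3) \<open>1 \<le> m\<close> by linarith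
qed

text \<open>The center goes to \<open>v\<close> and the leaves go bijectively onto \<open>L\<close>.
  The edge inclusion lets \<open>T\<close> inherit the single color of a monochromatic star, even
  when \<open>H\<close> is a proper subgraph of the star.\<close>

lemma copies_from_star:
  assumes S: "S \<in> copies H (complete_bipartite 1 m)" and K: "sgraph K"
    and L: "L \<subseteq> neighbours K v" "card L = m" "0 < m"
  obtains T where "T \<in> copies H K" "edges T \<subseteq> edges (star v L)"
proof -
  have "finite L"
    using L card_ge_0_finite by blast
  obtain h where h: "bij_betw h {..<m} L"
    using \<open>finite L\<close> L(2) by (metis ex_bij_betw_nat_finite atLeast0LessThan)
  let ?g = "case_sum (\<lambda>_. v) h"
  have E: "{v, u} \<in> edges K" if "u \<in> L" for u
    using that L(1) by (auto simp: neighbours_def)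
  then have uv: "u \<noteq> v \<and> u \<in> verts K \<and> v \<in> verts K" if "u \<in> L" for u
    using that K by (fastforce simp: sgraph_def)
  have "L \<noteq> {}"
    using L by auto
  have hL: "h j \<in> L" if "j < m" for j
    using h that by (auto simp: bij_betw_def)
  have im: "?g ` e \<in> edges (star v L)" if "e \<in> edges (complete_bipartite 1 m)" for e
    using that hL by (auto simp: edges_complete_bipartite_1)
  have sub: "edges (star v L) \<subseteq> edges K"
    using L(1) by (simp only: edges_star_subset_iff)
  have "(?g ` verts S, (`) ?g ` edges S) \<in> copies H K"
  proof (rule copies_embed[OF S])
    show "inj_on ?g (verts (complete_bipartite 1 m))"
      using h uv by (auto simp: bij_betw_def verts_complete_bipartite_1 inj_on_def)
    show "?g ` verts (complete_bipartite 1 m) \<subseteq> verts K"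
      using hL uv \<open>L \<noteq> {}\<close> by (auto simp: verts_complete_bipartite_1)
    show "?g ` e \<in> edges K" if "e \<in> edges (complete_bipartite 1 m)" for e
      using im[OF that] sub by blast
  qed
  moreover have "edges S \<subseteq> edges (complete_bipartite 1 m)"
    using S by (auto simp: copies_def subgraph_def)
  then have "(`) ?g ` edges S \<subseteq> edges (star v L)"
    using im by blast
  ultimately show ?thesis
    using that by fastforce
qed

text \<open>Choose one neighbour for each of three colors seen at \<open>v\<close>.\<close>

lemma rainbow_claw:
  assumes K: "sgraph K" and "2 < card ((\<lambda>u. c {v, u}) ` neighbours K v)"
  shows "rainbow_copies c (complete_bipartite 1 3) K \<noteq> {}"
proof -
  have "3 \<le> card ((\<lambda>u. c {v, u}) ` neighbours K v)"
    using assms(2) by simp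
  then obtain A where A: "A \<subseteq> (\<lambda>u. c {v, u}) ` neighbours K v" "card A = 3"
    by (rule obtain_subset_with_card_n)
  then obtain L where L: "L \<subseteq> neighbours K v" "inj_on (\<lambda>u. c {v, u}) L" "A = (\<lambda>u. c {v, u}) ` L"
    by (meson subset_image_inj)
  then have "card L = 3"
    using A(2) card_image by metis
  moreover have "rainbow c (star v L)"
    using L(2) by (auto simp: rainbow_def inj_on_def)
  ultimately have "star v L \<in> rainbow_copies c (complete_bipartite 1 3) K"
    using L(1) by (auto simp: rainbow_copies_def copies_star_eq[OF K])
  then show ?thesis
    by blast
qed

lemma gallai_ramsey_star:
  assumes "3 \<le> n" "0 < m" "2 * m \<le> r"
    and c: "exact_edge_coloring r (complete_bipartite n n) c"
    and H: "copies H (complete_bipartite 1 m) \<noteq> {}"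
  shows "rainbow_copies c (complete_bipartite 1 3) (complete_bipartite n n) \<noteq> {}
    \<or> mono_copies c H (complete_bipartite n n) \<noteq> {}"
proof (rule disjCI)
  let ?K = "complete_bipartite n n"
  define f where "f i j = c {Inl i, Inr j}" for i j
  assume no: "\<not> mono_copies c H ?K \<noteq> {}"
  have K: "sgraph ?K"
    using assms(1) by (simp add: sgraph_complete_bipartite)
  show "rainbow_copies c (complete_bipartite 1 3) ?K \<noteq> {}"
  proof (rule ccontr)
    assume "\<not> ?thesis"
    then have two: "card ((\<lambda>u. c {v, u}) ` neighbours ?K v) \<le> 2" for v
      using rainbow_claw[OF K] not_less by blast
    have rows: "card (f i ` {..<n}) \<le> 2" if "i < n" for i
      using two[of "Inl i"] that by (simp add: neighbours_Inl image_image f_def)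
    have cols: "card ((\<lambda>i. f i j) ` {..<n}) \<le> 2" if "j < n" for j
      using two[of "Inr j"] that by (simp add: neighbours_Inr image_image f_def insert_commute)
    have "(\<Union>i<n. f i ` {..<n}) = c ` edges ?K"
      by (auto simp: edges_complete_bipartite f_def image_iff)
    then have "r = card (\<Union>i<n. f i ` {..<n})"
      using c by (simp add: exact_edge_coloring_def)
    then have "r \<le> n + 1"
      using two_colored_lines[OF assms(1) rows cols] by simp
    \<comment> \<open>The chain 2m \<le> r \<le> n + 1 is the size condition of
      \<open>large_fibre\<close> for row 0, whose n entries show at most two colors.\<close>
    then obtain x where x: "m \<le> card {j \<in> {..<n}. f 0 j = x}"
      using large_fibre[of "{..<n}" "f 0" m] rows[of 0] assms by auto
    then obtain J where J: "J \<subseteq> {j \<in> {..<n}. f 0 j = x}" "card J = m"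
      by (meson obtain_subset_with_card_n)
    obtain S where S: "S \<in> copies H (complete_bipartite 1 m)"
      using H by blast
    obtain T where T: "T \<in> copies H ?K" "edges T \<subseteq> edges (star (Inl 0) (Inr ` J))"
    proof (rule copies_from_star[OF S K])
      show "Inr ` J \<subseteq> neighbours ?K (Inl 0)"
        using J(1) assms(1) by (auto simp: neighbours_Inl)
      show "card (Inr ` J :: (nat + nat) set) = m"
        using J(2) by (simp add: card_image)
    qed (use assms(2) in auto)
    have "c e = x" if "e \<in> edges T" for e
      using T(2) J(1) that by (auto simp: f_def)
    then have "monochromatic c T"
      by (simp add: monochromatic_def)
    then show False
      using T(1) no unfolding mono_copies_def by blast
  qed
qed

text \<open>The upper bound is \<open>gallai_ramsey_star\<close>. The lower bound is an edge count:
  for N < t the graph has at most (t - 1)^2 edges, fewer than the t^2 - 1 colors.\<close>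

lemma bgr_star:
  assumes "3 \<le> t" "0 < m" "2 * m \<le> t\<^sup>2 - 1"
    and "copies H (complete_bipartite 1 m) \<noteq> {}"
  shows "bgr (t\<^sup>2 - 1) (complete_bipartite 1 3) H = t"
  unfolding bgr_def
proof (rule Least_equality)
  show "t\<^sup>2 - 1 \<le> t\<^sup>2 \<and> (\<forall>n\<ge>t. \<forall>c. exact_edge_coloring (t\<^sup>2 - 1) (complete_bipartite n n) c \<longrightarrow>
      rainbow_copies c (complete_bipartite 1 3) (complete_bipartite n n) \<noteq> {} \<or>
      mono_copies c H (complete_bipartite n n) \<noteq> {})"
    using gallai_ramsey_star[of _ m "t\<^sup>2 - 1" _ H] assms by auto
next
  fix N
  assume "t\<^sup>2 - 1 \<le> N\<^sup>2 \<and> (\<forall>n\<ge>N. \<forall>c. exact_edge_coloring (t\<^sup>2 - 1) (complete_bipartite n n) c \<longrightarrow>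
      rainbow_copies c (complete_bipartite 1 3) (complete_bipartite n n) \<noteq> {} \<or>
      mono_copies c H (complete_bipartite n n) \<noteq> {})"
  then have N: "t\<^sup>2 \<le> N\<^sup>2 + 1"
    by linarith
  show "t \<le> N"
  proof (rule ccontr)
    assume "\<not> t \<le> N"
    then have "(N + 1)\<^sup>2 \<le> t\<^sup>2"
      by (intro power_mono) auto
    with N have "N = 0"
      unfolding power2_eq_square by (simp add: algebra_simps)
    moreover have "3\<^sup>2 \<le> t\<^sup>2"
      using assms(1) by (intro power_mono) auto
    ultimately show False
      using N by simp
  qed
qed

section \<open>Colorings with a single repetition\<close>

text \<open>Some two elements collide, and removing one of them loses no color; what remains has as
  many colors as elements. Injectivity off \<open>e1\<close> encodes that this collision is the only
  one.\<close>

lemma single_repetition: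
  assumes "finite E" "card (c ` E) + 1 = card E"
  obtains e1 e2 where "e1 \<in> E" "e2 \<in> E" "e1 \<noteq> e2" "c e1 = c e2" "inj_on c (E - {e1})"
proof -
  have "\<not> inj_on c E"
    using assms(2) card_image by fastforce
  then obtain e1 e2 where e: "e1 \<in> E" "e2 \<in> E" "e1 \<noteq> e2" "c e1 = c e2"
    by (auto simp: inj_on_def)
  then have "c ` (E - {e1}) = c ` E"
    by (auto simp: image_iff)
  then have "card (c ` (E - {e1})) = card (E - {e1})"
    using assms e(1) by simp
  then have "inj_on c (E - {e1})"
    using assms(1) by (intro eq_card_imp_inj_on) auto
  with e show ?thesis
    by (rule that)
qed

text \<open>Of three edges of a copy at least two differ from \<open>e1\<close>, and these have
  different colors.\<close>

lemma no_mono_copies: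
  assumes "inj_on c (edges K - {e1})" "sgraph H" "3 \<le> card (edges H)"
  shows "mono_copies c H K = {}"
proof (rule ccontr)
  assume "\<not> ?thesis"
  then obtain S where S: "S \<in> copies H K" "monochromatic c S"
    by (auto simp: mono_copies_def)
  have "edges S \<subseteq> edges K"
    using S(1) by (auto simp: copies_def subgraph_def)
  have eq: "e = e'" if "e \<in> edges S - {e1}" "e' \<in> edges S - {e1}" for e e'
  proof (rule inj_onD[OF assms(1)])
    show "c e = c e'"
      using that S(2) by (simp add: monochromatic_def)
  qed (use that \<open>edges S \<subseteq> edges K\<close> in auto)
  have "3 \<le> card (edges S)"
    using card_edges_copy[OF S(1) assms(2)] assms(3) by simp
  then have "2 \<le> card (edges S - {e1})"
    using diff_card_le_card_Diff[of "{e1}" "edges S"] by simp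
  then obtain A where "A \<subseteq> edges S - {e1}" "card A = 2"
    by (rule obtain_subset_with_card_n)
  then obtain a b where "a \<noteq> b" "{a, b} \<subseteq> edges S - {e1}"
    by (auto simp: card_2_iff)
  then show False
    using eq[of a b] by simp
qed

lemma nonrainbow_iff:
  assumes "e1 \<in> E" "e2 \<in> E" "e1 \<noteq> e2" "c e1 = c e2" "inj_on c (E - {e1})" "A \<subseteq> E"
  shows "\<not> inj_on c A \<longleftrightarrow> e1 \<in> A \<and> e2 \<in> A"
proof
  assume "\<not> inj_on c A"
  then obtain a b where ab: "a \<in> A" "b \<in> A" "a \<noteq> b" "c a = c b"
    by (auto simp: inj_on_def)
  \<comment> \<open>By injectivity off \<open>e1\<close>, the edge \<open>e2\<close> is the only
    other one with the color of \<open>e1\<close>.\<close>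
  have partner: "b = e2" if "b \<in> A" "b \<noteq> e1" "c b = c e1" for b
    using that assms by (intro inj_onD[OF assms(5)]) auto
  have "a = e1 \<or> b = e1"
    using ab assms(6) inj_onD[OF assms(5), of a b] by blast
  then show "e1 \<in> A \<and> e2 \<in> A"
    using partner[of a] partner[of b] ab by auto
qed (use assms in \<open>auto simp: inj_on_def\<close>)

text \<open>Two distinct edges at \<open>v\<close> force the center and two leaves of the claw; only
  the third leaf \<open>z\<close> is free.\<close>

lemma claws_through_two_edges:
  assumes K: "sgraph K" and e: "{v, x} \<in> edges K" "{v, y} \<in> edges K" "x \<noteq> y"
  shows "{S \<in> copies (complete_bipartite 1 3) K. {v, x} \<in> edges S \<and> {v, y} \<in> edges S}
    = (\<lambda>z. star v {x, y, z}) ` (neighbours K v - {x, y})" (is "?A = ?B")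
proof (intro set_eqI iffI)
  fix S assume "S \<in> ?A"
  then obtain w L where S: "S = star w L" and L: "L \<subseteq> neighbours K w" "card L = 3"
    and mem: "{v, x} \<in> edges (star w L)" "{v, y} \<in> edges (star w L)"
    by (auto simp: copies_star_eq[OF K])
  have "v = w" "x \<in> L" "y \<in> L"
    using mem e(3) by (auto simp: doubleton_eq_iff)
  have "finite L"
    using L(2) card_ge_0_finite by force
  then have "card (L - {x, y}) = 1"
    using L(2) \<open>x \<in> L\<close> \<open>y \<in> L\<close> e(3) by (simp add: card_Diff_subset)
  then obtain z where "L - {x, y} = {z}"
    by (rule card_1_singletonE)
  then have "L = {x, y, z}" "z \<in> neighbours K v - {x, y}"
    using \<open>x \<in> L\<close> \<open>y \<in> L\<close> L(1) \<open>v = w\<close> by auto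
  with S \<open>v = w\<close> show "S \<in> ?B"
    by blast
next
  fix S assume "S \<in> ?B"
  then obtain z where S: "S = star v {x, y, z}" and z: "z \<in> neighbours K v - {x, y}"
    by blast
  have "{x, y, z} \<subseteq> neighbours K v" "card {x, y, z} = 3"
    using z e by (auto simp: neighbours_def)
  then have "S \<in> copies (complete_bipartite 1 3) K"
    unfolding copies_star_eq[OF K, of 3, simplified] using S by blast
  then show "S \<in> ?A"
    by (simp add: S)
qed

text \<open>The third leaf can be read off the vertex set of the claw, since it differs from
  \<open>v\<close>, \<open>x\<close> and \<open>y\<close>.\<close>

lemma card_claws_through_two_edges:
  assumes K: "sgraph K" and e: "{v, x} \<in> edges K" "{v, y} \<in> edges K" "x \<noteq> y"
  shows "card {S \<in> copies (complete_bipartite 1 3) K. {v, x} \<in> edges S \<and> {v, y} \<in> edges S}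
    = card (neighbours K v) - 2"
proof -
  have xy: "{x, y} \<subseteq> neighbours K v"
    using e by (auto simp: neighbours_def)
  have "z = z'" if "star v {x, y, z} = star v {x, y, z'}"
      "z \<in> neighbours K v - {x, y}" "z' \<in> neighbours K v - {x, y}" for z z'
  proof -
    have "insert v {x, y, z} = insert v {x, y, z'}"
      using that(1) by (metis verts_star)
    moreover have "z \<noteq> v"
      using that(2) not_in_neighbours[OF K] by blast
    ultimately show ?thesis
      using that(2) by blast
  qed
  then have "inj_on (\<lambda>z. star v {x, y, z}) (neighbours K v - {x, y})"
    by (auto intro!: inj_onI)
  then show ?thesis
    using xy e(3) by (simp add: claws_through_two_edges[OF assms] card_image card_Diff_subset)
qed

text \<open>Counting by complement: the non-rainbow claws are those containing both
  \<open>e1\<close> and \<open>e2\<close>. Edges of a claw share its center, so disjoint edges spoil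
  no claw, while meeting edges spoil one for each choice of a third leaf.\<close>

lemma card_rainbow_claws:
  assumes "0 < n"
    and rep: "e1 \<in> edges (complete_bipartite n n)" "e2 \<in> edges (complete_bipartite n n)"
      "e1 \<noteq> e2" "c e1 = c e2" "inj_on c (edges (complete_bipartite n n) - {e1})"
  shows "card (rainbow_copies c (complete_bipartite 1 3) (complete_bipartite n n))
    = 2 * n * (n choose 3) - (if e1 \<inter> e2 = {} then 0 else n - 2)"
proof -
  let ?K = "complete_bipartite n n"
  let ?A = "copies (complete_bipartite 1 3) ?K"
  let ?B = "{S \<in> ?A. e1 \<in> edges S \<and> e2 \<in> edges S}"
  have K: "sgraph ?K"
    using assms(1) by (simp add: sgraph_complete_bipartite)
  have "rainbow_copies c (complete_bipartite 1 3) ?K = ?A - ?B"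
  proof -
    have "\<not> rainbow c S \<longleftrightarrow> e1 \<in> edges S \<and> e2 \<in> edges S" if "S \<in> ?A" for S
      unfolding rainbow_def using that
      by (intro nonrainbow_iff[OF rep]) (auto simp: copies_def subgraph_def)
    then show ?thesis
      by (auto simp: rainbow_copies_def)
  qed
  moreover have "finite ?A"
    using card_copies_star(1)[OF K] by simp
  ultimately have "card (rainbow_copies c (complete_bipartite 1 3) ?K) = 2 * n * (n choose 3) - card ?B"
    using card_claws[OF assms(1)] by (simp add: card_Diff_subset)
  moreover have "card ?B = (if e1 \<inter> e2 = {} then 0 else n - 2)"
  proof (cases "e1 \<inter> e2 = {}")
    case True
    have "S \<notin> ?B" for S
    proof
      assume S: "S \<in> ?B"
      then obtain v L where "S = star v L"
        by (auto simp: copies_star_eq[OF K])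
      then have "v \<in> e1" "v \<in> e2"
        using S by auto
      with True show False
        by blast
    qed
    then have "?B = {}"
      by blast
    then have "card ?B = 0"
      by (simp only: card.empty)
    with True show ?thesis
      by simp
  next
    case False
    then obtain v where v: "v \<in> e1" "v \<in> e2"
      by blast
    have "card e1 = 2" "card e2 = 2" "v \<in> verts ?K"
      using K rep v by (auto simp: sgraph_def)
    then obtain x y where xy: "e1 = {v, x}" "e2 = {v, y}"
      using v by (metis card_2_iff doubleton_eq_iff insertE singletonD)
    then have "x \<noteq> y"
      using rep(3) by blast
    then show ?thesis
      using card_claws_through_two_edges[OF K, of v x y] rep xy False card_neighbours[OF \<open>v \<in> verts ?K\<close>]
      by simp
  qed
  ultimately show ?thesis
    by simp
qed

text \<open>Number the elements other than \<open>e1\<close> bijectively, then give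
  \<open>e1\<close> the color of \<open>e2\<close>.\<close>

lemma ex_coloring_with_repetition:
  assumes "finite E" "e1 \<in> E" "e2 \<in> E" "e1 \<noteq> e2"
  obtains c :: "'a \<Rightarrow> nat" where "c ` E = {1..card E - 1}" "c e1 = c e2" "inj_on c (E - {e1})"
proof -
  obtain h where h: "bij_betw h (E - {e1}) {1..card (E - {e1})}"
    using finite_same_card_bij[of "E - {e1}" "{1..card (E - {e1})}"] assms(1) by auto
  let ?c = "h(e1 := h e2)"
  have "inj_on ?c (E - {e1})"
    using h by (auto simp: bij_betw_def inj_on_def)
  moreover have "?c ` E = h ` (E - {e1})"
    using assms by (auto simp: image_iff)
  then have "?c ` E = {1..card E - 1}"
    using bij_betw_imp_surj_on[OF h] assms(1,2) by (simp only: card_Diff_singleton)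
  ultimately show ?thesis
    using that[of ?c] assms(4) by simp
qed

lemma bi_GM_star:
  assumes "3 \<le> t" "0 < m" "2 * m \<le> t\<^sup>2 - 1" "copies H (complete_bipartite 1 m) \<noteq> {}"
    and H: "sgraph H" "3 \<le> card (edges H)"
  shows "bi_GM (t\<^sup>2 - 1) (complete_bipartite 1 3) H = 2 * t * (t choose 3) - (t - 2)"
proof -
  let ?K = "complete_bipartite t t"
  have cardE: "card (edges ?K) = t\<^sup>2"
    by (simp add: card_edges_complete_bipartite power2_eq_square)
  then have finE: "finite (edges ?K)"
    using assms(1) by (intro card_ge_0_finite) simp
  have "0 < t"
    using assms(1) by simp
  show ?thesis
    unfolding bi_GM_def bgr_star[OF assms(1-4)] Let_def
  proof (rule Least_equality)
    \<comment> \<open>These edges meet in \<open>Inl 0\<close>, so repeating a color on them spoils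
      t - 2 claws, which attains the minimum; \<open>3 \<le> t\<close> ensures that
      \<open>Inr 1\<close> is a vertex.\<close>
    let ?e1 = "{Inl 0, Inr 0} :: (nat + nat) set"
    let ?e2 = "{Inl 0, Inr 1} :: (nat + nat) set"
    have e: "?e1 \<in> edges ?K" "?e2 \<in> edges ?K" "?e1 \<noteq> ?e2"
      using assms(1) by (auto simp: doubleton_eq_iff)
    obtain c :: "(nat + nat) set \<Rightarrow> nat" where c: "c ` edges ?K = {1..card (edges ?K) - 1}"
        "c ?e1 = c ?e2" "inj_on c (edges ?K - {?e1})"
      by (rule ex_coloring_with_repetition[OF finE e])
    have "exact_edge_coloring (t\<^sup>2 - 1) ?K c"
      using c(1) cardE by (simp add: exact_edge_coloring_def)
    moreover have "2 * t * (t choose 3) - (t - 2)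
        = card (rainbow_copies c (complete_bipartite 1 3) ?K) + card (mono_copies c H ?K)"
      using card_rainbow_claws[OF \<open>0 < t\<close> e c(2,3)] no_mono_copies[OF c(3) H] by simp
    ultimately show "\<exists>c. exact_edge_coloring (t\<^sup>2 - 1) ?K c \<and> 2 * t * (t choose 3) - (t - 2)
        = card (rainbow_copies c (complete_bipartite 1 3) ?K) + card (mono_copies c H ?K)"
      by blast
  next
    fix l
    assume "\<exists>c. exact_edge_coloring (t\<^sup>2 - 1) ?K c
      \<and> l = card (rainbow_copies c (complete_bipartite 1 3) ?K) + card (mono_copies c H ?K)"
    then obtain c where c: "c ` edges ?K = {1..t\<^sup>2 - 1}"
      and l: "l = card (rainbow_copies c (complete_bipartite 1 3) ?K) + card (mono_copies c H ?K)"
      by (auto simp: exact_edge_coloring_def)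
    have "card (c ` edges ?K) + 1 = card (edges ?K)"
      using c cardE \<open>0 < t\<close> by simp
    then obtain e1 e2 where e: "e1 \<in> edges ?K" "e2 \<in> edges ?K" "e1 \<noteq> e2" "c e1 = c e2"
        "inj_on c (edges ?K - {e1})"
      using single_repetition[OF finE] by blast
    \<comment> \<open>Whether \<open>e1\<close> and \<open>e2\<close> meet or not, at most t - 2
      claws are lost.\<close>
    show "2 * t * (t choose 3) - (t - 2) \<le> l"
      using l card_rainbow_claws[OF \<open>0 < t\<close> e] by (simp add: trans_le_add1)
  qed
qed

text \<open>Vandermonde: a 3-subset takes none, one or both of two distinguished elements.\<close>

lemma choose_3_split: "(n + 2) choose 3 = (n choose 3) + 2 * (n choose 2) + n"
  by (simp add: numeral_eq_Suc)

theorem theorem4p7: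
  fixes k t :: nat and H :: "'a graph"
  assumes "k = t\<^sup>2" and "k \<ge> 9"
    and "sgraph H"
    and "copies H (complete_bipartite 1 (nat \<lceil>(real k - 2) / 2\<rceil>)) \<noteq> {}"
    and "card (edges H) \<ge> 3"
  shows "bi_GM (k - 1) (complete_bipartite 1 3) H =
    (if t = 3 then 5
     else if t = 4 then 30
     else (2 * t - 1) * (t choose 3) + ((t - 2) choose 3) + 2 * ((t - 2) choose 2))"
proof -
  have t: "3 \<le> t"
  proof (rule ccontr)
    assume "\<not> 3 \<le> t"
    then have "t\<^sup>2 \<le> 2\<^sup>2"
      by (intro power_mono) auto
    with assms(1,2) show False
      by simp
  qed
  define m where "m = nat \<lceil>(real k - 2) / 2\<rceil>"
  have "0 < m"
    using assms(2) by (simp add: m_def)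
  \<comment> \<open>A ceiling exceeds its argument by less than 1, so 2m < k, the bound needed for k
    - 1 colors.\<close>
  then have "real m < (real k - 2) / 2 + 1"
    unfolding m_def by linarith
  then have "2 * m \<le> t\<^sup>2 - 1"
  proof -
    have "2 * m < k"
      using \<open>real m < _\<close> by (simp add: field_simps)
    then show ?thesis
      using assms(1) by simp
  qed
  with \<open>0 < m\<close> have "bi_GM (k - 1) (complete_bipartite 1 3) H = 2 * t * (t choose 3) - (t - 2)"
    using bi_GM_star[of t m H] t assms by (simp add: m_def)
  also have "\<dots> = (2 * t - 1) * (t choose 3) + ((t - 2) choose 3) + 2 * ((t - 2) choose 2)"
  proof -
    \<comment> \<open>One summand (t choose 3) is split off and expanded with n = t - 2; the last
      term n of the expansion cancels the subtracted t - 2.\<close>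
    obtain n where n: "t = n + 2"
      using t by (intro that[of "t - 2"]) simp
    have "2 * t * (t choose 3) = (2 * t - 1) * (t choose 3) + (t choose 3)"
      using t by (simp add: algebra_simps flip: add_mult_distrib)
    then show ?thesis
      using choose_3_split[of n] n by simp
  qed
  \<comment> \<open>The general formula already yields 5 * 1 + 0 + 0 = 5 at t = 3 and 7 * 4 + 0 + 2
    = 30 at t = 4.\<close>
  also have "\<dots> = (if t = 3 then 5 else if t = 4 then 30
     else (2 * t - 1) * (t choose 3) + ((t - 2) choose 3) + 2 * ((t - 2) choose 2))"
    by (simp add: numeral_eq_Suc)
  finally show ?thesis .
qed

end
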